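(* Let $R$ be a weakly cobleached local ring. Then the following are equivalent: (1) $M_2(R)$ is perfectly clean. (2) $M_2(R)$ is strongly clean. (3) For any $A\in M_2(R)$, $A\in GL_2(R)$, or $I_2-A\in GL_2(R)$, or $A$ is similar to a diagonal matrix.
   Context: Rings are associative with identity, not necessarily commutative. $U(S)$ is the group of invertible elements of a ring $S$ and $J(S)$ its Jacobson radical. For $a\in S$, $comm(a)=\{x\in S\mid xa=ax\}$ and $comm^2(a)=\{x\in S\mid xy=yx \text{ for all } y\in comm(a)\}$. An element $a\in S$ is perfectly clean if there is an idempotent $e\in comm^2(a)$ with $a-e\in U(S)$; it is strongly clean if there is an idempotent $e\in comm(a)$ with $a-e\in U(S)$. $S$ is perfectly clean (resp. strongly clean) if every element of $S$ is. A ring is local if it has only one maximal right ideal. For $a,b\in R$, $l_a-r_b$ denotes the additive map $R\to R$, $x\mapsto ax-xb$. A ring $R$ is weakly cobleached if for any $a\in J(R)$ and $b\in 1+J(R)$, the maps $l_a-r_b$ and $l_b-r_a$ are both injective. $M_2(R)$ is the ring of $2\times 2$ matrices over $R$ and $GL_2(R)=U(M_2(R))$; $A$ is similar to $B$ if $B=PAP^{-1}$ for some $P\in GL_2(R)$. *)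

theory Defs
  imports "HOL-Algebra.Ideal" "Jordan_Normal_Form.Matrix" "Jordan_Normal_Form.VS_Connect"
begin

section \<open>Right ideals, the Jacobson radical and local rings\<close>

text \<open>HOL-Algebra only has two-sided ideals; the two locales below are their one-sided versions.\<close>

locale right_ideal = additive_subgroup I R + ring R for I and R (structure) +
  assumes I_r_closed: "\<lbrakk>a \<in> I; x \<in> carrier R\<rbrakk> \<Longrightarrow> a \<otimes> x \<in> I"

locale maximal_right_ideal = right_ideal +
  assumes I_notcarr: "carrier R \<noteq> I"
    and I_maximal: "\<lbrakk>right_ideal J R; I \<subseteq> J; J \<subseteq> carrier R\<rbrakk> \<Longrightarrow> J = I \<or> J = carrier R"

definition jacobson_radical :: "('a, 'm) ring_scheme \<Rightarrow> 'a set" where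
  "jacobson_radical R = {x \<in> carrier R. \<forall>I. maximal_right_ideal I R \<longrightarrow> x \<in> I}"

definition local_ring :: "('a, 'm) ring_scheme \<Rightarrow> bool" where
  "local_ring R \<longleftrightarrow> ring R \<and> (\<exists>!I. maximal_right_ideal I R)"

definition weakly_cobleached :: "('a, 'm) ring_scheme \<Rightarrow> bool" where
  "weakly_cobleached R \<longleftrightarrow>
     (\<forall>a \<in> jacobson_radical R. \<forall>b \<in> {\<one>\<^bsub>R\<^esub> \<oplus>\<^bsub>R\<^esub> j | j. j \<in> jacobson_radical R}.
        inj_on (\<lambda>x. a \<otimes>\<^bsub>R\<^esub> x \<ominus>\<^bsub>R\<^esub> x \<otimes>\<^bsub>R\<^esub> b) (carrier R) \<and>
        inj_on (\<lambda>x. b \<otimes>\<^bsub>R\<^esub> x \<ominus>\<^bsub>R\<^esub> x \<otimes>\<^bsub>R\<^esub> a) (carrier R))"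


section \<open>Strongly clean and perfectly clean rings\<close>

definition commutant :: "('a, 'm) ring_scheme \<Rightarrow> 'a \<Rightarrow> 'a set" where
  "commutant S a = {x \<in> carrier S. x \<otimes>\<^bsub>S\<^esub> a = a \<otimes>\<^bsub>S\<^esub> x}"

definition double_commutant :: "('a, 'm) ring_scheme \<Rightarrow> 'a \<Rightarrow> 'a set" where
  "double_commutant S a =
     {x \<in> carrier S. \<forall>y \<in> commutant S a. x \<otimes>\<^bsub>S\<^esub> y = y \<otimes>\<^bsub>S\<^esub> x}"

definition strongly_clean_elem :: "('a, 'm) ring_scheme \<Rightarrow> 'a \<Rightarrow> bool" where
  "strongly_clean_elem S a \<longleftrightarrow>
     (\<exists>e \<in> commutant S a. e \<otimes>\<^bsub>S\<^esub> e = e \<and> a \<ominus>\<^bsub>S\<^esub> e \<in> Units S)"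

definition perfectly_clean_elem :: "('a, 'm) ring_scheme \<Rightarrow> 'a \<Rightarrow> bool" where
  "perfectly_clean_elem S a \<longleftrightarrow>
     (\<exists>e \<in> double_commutant S a. e \<otimes>\<^bsub>S\<^esub> e = e \<and> a \<ominus>\<^bsub>S\<^esub> e \<in> Units S)"

definition strongly_clean :: "('a, 'm) ring_scheme \<Rightarrow> bool" where
  "strongly_clean S \<longleftrightarrow> (\<forall>a \<in> carrier S. strongly_clean_elem S a)"

definition perfectly_clean :: "('a, 'm) ring_scheme \<Rightarrow> bool" where
  "perfectly_clean S \<longleftrightarrow> (\<forall>a \<in> carrier S. perfectly_clean_elem S a)"


section \<open>The ring of two-by-two matrices\<close>

abbreviation mat2_ring :: "'a :: ring_1 itself \<Rightarrow> 'a mat ring" where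
  "mat2_ring ty \<equiv> ring_mat ty 2 ()"

abbreviation GL2 :: "'a :: ring_1 itself \<Rightarrow> 'a mat set" where
  "GL2 ty \<equiv> Units (mat2_ring ty)"

text \<open>The library proves the next fact for commutative coefficients only.\<close>

lemma ring_ring_mat: "ring (ring_mat TYPE('a :: ring_1) n b)"
  by (unfold_locales, insert add_inv_exists_mat, auto simp: ring_mat_def algebra_simps Units_def)

lemma ring_mat_minus:
  fixes A B :: "'a :: ring_1 mat"
  assumes A: "A \<in> carrier_mat n n" and B: "B \<in> carrier_mat n n"
  shows "A \<ominus>\<^bsub>ring_mat TYPE('a) n b\<^esub> B = A - B"
proof -
  let ?M = "ring_mat TYPE('a) n b"
  interpret ring ?M by (rule ring_ring_mat)
  have "\<ominus>\<^bsub>?M\<^esub> B = - B"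
    by (rule minus_equality) (use B in \<open>auto simp: ring_mat_simps\<close>)
  then show ?thesis
    using A B by (auto simp: a_minus_def ring_mat_simps add_uminus_minus_mat)
qed

lemma class_ring_minus:
  "(x :: 'a :: ring_1) \<ominus>\<^bsub>class_ring\<^esub> y = x - y"
proof -
  have "abelian_group (class_ring :: 'a ring)"
    using class_ring.ring_axioms by (rule ring.is_abelian_group)
  then have "\<ominus>\<^bsub>class_ring\<^esub> y = - y"
    by (rule abelian_group.minus_equality) auto
  then show ?thesis by (simp add: a_minus_def)
qed

end

theory Submission
  imports Defs
begin

text \<open>Over a local ring the idempotents of \<open>M\<^sub>2(R)\<close> are \<open>0\<close>, \<open>1\<close> and conjugates of \<open>diag(1, 0)\<close>,
  so a strongly clean \<open>A\<close> is a unit, or \<open>1 - A\<close> is one, or \<open>A\<close> commutes with a conjugate of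
  \<open>diag(1, 0)\<close> and is diagonalised by the same conjugation. Conversely, perfect cleanness is
  invariant under conjugation. For \<open>diag(a, b)\<close> with \<open>a\<close> in the radical and \<open>b\<close> in one plus the
  radical, injectivity of \<open>x \<mapsto> a x - x b\<close> and \<open>x \<mapsto> b x - x a\<close> forces the commutant to consist of
  diagonal matrices, hence \<open>diag(1, 0)\<close> lies in the double commutant.\<close>

section \<open>Local rings\<close>

context ring
begin

section \<open>Right ideals and the existence of maximal ones\<close>

lemma right_idealI:
  assumes "I \<subseteq> carrier R" "\<zero> \<in> I"
    and add: "\<And>x y. \<lbrakk>x \<in> I; y \<in> I\<rbrakk> \<Longrightarrow> x \<oplus> y \<in> I"
    and mult: "\<And>a x. \<lbrakk>a \<in> I; x \<in> carrier R\<rbrakk> \<Longrightarrow> a \<otimes> x \<in> I"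
  shows "right_ideal I R"
proof -
  \<comment> \<open>Negatives come from absorption, as \<open>\<ominus> a\<close> is the right
    multiple of \<open>a\<close> by \<open>\<ominus> \<one>\<close>.\<close>
  have neg: "\<ominus> a \<in> I" if "a \<in> I" for a
  proof -
    have "a \<otimes> (\<ominus> \<one>) \<in> I" using mult[OF that] by simp
    moreover have "a \<otimes> (\<ominus> \<one>) = \<ominus> a" using that assms(1) by (auto simp: r_minus)
    ultimately show ?thesis by simp
  qed
  have "subgroup I (add_monoid R)"
    by (rule add.subgroupI) (use assms neg in \<open>auto simp: a_inv_def\<close>)
  then show ?thesis
    by (intro right_ideal.intro right_ideal_axioms.intro additive_subgroup.intro ring_axioms mult)
qed

lemma principal_right_ideal:
  assumes a: "a \<in> carrier R"
  shows "right_ideal ((\<lambda>x. a \<otimes> x) ` carrier R) R"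
proof (rule right_idealI)
  show "\<zero> \<in> (\<lambda>x. a \<otimes> x) ` carrier R"
    by (rule image_eqI[of _ _ \<zero>]) (use a in auto)
next
  fix x y assume "x \<in> (\<lambda>x. a \<otimes> x) ` carrier R" "y \<in> (\<lambda>x. a \<otimes> x) ` carrier R"
  then obtain u v where "u \<in> carrier R" "v \<in> carrier R" "x = a \<otimes> u" "y = a \<otimes> v" by auto
  then show "x \<oplus> y \<in> (\<lambda>x. a \<otimes> x) ` carrier R"
    using a by (intro image_eqI[of _ _ "u \<oplus> v"]) (auto simp: r_distr)
next
  fix b x assume "b \<in> (\<lambda>x. a \<otimes> x) ` carrier R" and x: "x \<in> carrier R"
  then obtain u where "u \<in> carrier R" "b = a \<otimes> u" by auto
  then show "b \<otimes> x \<in> (\<lambda>x. a \<otimes> x) ` carrier R"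
    using a x by (intro image_eqI[of _ _ "u \<otimes> x"]) (auto simp: m_assoc)
qed (use a in auto)

lemma right_ideal_one_imp_carrier:
  assumes "right_ideal I R" "\<one> \<in> I"
  shows "I = carrier R"
proof -
  interpret right_ideal I R by fact
  have "x \<in> I" if "x \<in> carrier R" for x
    using I_r_closed[OF assms(2) that] that by simp
  then show ?thesis using a_subset by auto
qed

text \<open>Zorn's lemma applies to the right ideals that contain \<open>I\<close> and omit
  \<open>\<one>\<close>: the union of a nonempty chain of them is again one. A maximal member is a
  maximal right ideal, since a right ideal is proper exactly when it omits
  \<open>\<one>\<close>.\<close>

lemma exists_maximal_right_ideal:
  assumes I: "right_ideal I R" and one: "\<one> \<notin> I"
  obtains M where "maximal_right_ideal M R" "I \<subseteq> M"
proof -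
  let ?\<A> = "{J. right_ideal J R \<and> I \<subseteq> J \<and> \<one> \<notin> J}"
  have "\<exists>M\<in>?\<A>. \<forall>X\<in>?\<A>. M \<subseteq> X \<longrightarrow> X = M"
  proof (rule subset_Zorn_nonempty)
    show "?\<A> \<noteq> {}" using I one by auto
  next
    fix C assume ne: "C \<noteq> {}" and C: "subset.chain ?\<A> C"
    have ri: "right_ideal X R" "I \<subseteq> X" "\<one> \<notin> X" if "X \<in> C" for X
      using C that by (auto simp: subset.chain_def)
    have sub: "additive_subgroup X R" if "X \<in> C" for X
      using ri(1)[OF that] by (rule right_ideal.axioms)
    have "right_ideal (\<Union>C) R"
    proof (rule right_idealI)
      show "\<Union>C \<subseteq> carrier R" using additive_subgroup.a_subset[OF sub] by blast
      show "\<zero> \<in> \<Union>C" using ne additive_subgroup.zero_closed[OF sub] by blast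
    next
      fix x y assume "x \<in> \<Union>C" "y \<in> \<Union>C"
      then obtain X Y where XY: "X \<in> C" "Y \<in> C" "x \<in> X" "y \<in> Y" by auto
      then have "X \<subseteq> Y \<or> Y \<subseteq> X" using C by (auto simp: subset.chain_def)
      then obtain Z where "Z \<in> C" "x \<in> Z" "y \<in> Z" using XY by blast
      then show "x \<oplus> y \<in> \<Union>C" using additive_subgroup.a_closed[OF sub] by blast
    next
      fix a x assume "a \<in> \<Union>C" "x \<in> carrier R"
      then show "a \<otimes> x \<in> \<Union>C" using right_ideal.I_r_closed[OF ri(1)] by blast
    qed
    then show "\<Union>C \<in> ?\<A>" using ri ne by blast
  qed
  then obtain M where M: "right_ideal M R" "I \<subseteq> M" "\<one> \<notin> M"
    and max: "\<And>X. \<lbrakk>right_ideal X R; \<one> \<notin> X; M \<subseteq> X\<rbrakk> \<Longrightarrow> X = M"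
    by (smt (verit, ccfv_threshold) mem_Collect_eq order_trans)
  have "maximal_right_ideal M R"
    using M max right_ideal_one_imp_carrier
    by (intro maximal_right_ideal.intro maximal_right_ideal_axioms.intro) auto
  then show thesis using M(2) that by blast
qed

text \<open>The radical is the unique maximal right ideal \<open>M\<close>. Elements outside
  \<open>M\<close> are shown to be two-sided units, and elements of \<open>M\<close> cannot be units
  because \<open>\<one> \<notin> M\<close>; invertibility outside \<open>M\<close> then gives
  absorption on the left.\<close>

lemma local_ring_radical:
  assumes "local_ring R"
  shows local_ring_radical_eq_nonunits: "jacobson_radical R = carrier R - Units R"
    and local_ring_radical_ideal: "ideal (jacobson_radical R) R"
proof -
  obtain M where M: "maximal_right_ideal M R"
    and uniq: "\<And>I. maximal_right_ideal I R \<Longrightarrow> I = M"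
    using assms unfolding local_ring_def by blast
  interpret maximal_right_ideal M R by (rule M)
  have J: "jacobson_radical R = M"
  proof -
    have "maximal_right_ideal I R \<longleftrightarrow> I = M" for I using M uniq by blast
    then show ?thesis using a_subset by (auto simp: jacobson_radical_def)
  qed
  have one: "\<one> \<notin> M"
    using right_ideal_one_imp_carrier[OF right_ideal_axioms] I_notcarr by auto
  \<comment> \<open>If \<open>x\<close> has no right inverse, the right ideal it generates is proper
    and lies in a maximal one, which can only be \<open>M\<close>.\<close>
  have rinv: "\<exists>y\<in>carrier R. x \<otimes> y = \<one>" if x: "x \<in> carrier R" "x \<notin> M" for x
  proof (rule ccontr)
    assume "\<not> ?thesis"
    then have "\<one> \<notin> (\<lambda>y. x \<otimes> y) ` carrier R" by auto
    then obtain N where "maximal_right_ideal N R" "(\<lambda>y. x \<otimes> y) ` carrier R \<subseteq> N"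
      using exists_maximal_right_ideal[OF principal_right_ideal[OF x(1)]] by blast
    then have "x \<otimes> \<one> \<in> M" using uniq by blast
    then show False using x by simp
  qed
  have compl: "\<one> \<ominus> x \<notin> M" if "x \<in> M" for x
  proof
    assume "\<one> \<ominus> x \<in> M"
    then have "\<one> \<ominus> x \<oplus> x \<in> M" using that by simp
    moreover have "\<one> \<ominus> x \<oplus> x = \<one>" using that a_subset by (auto simp: a_minus_def a_assoc l_neg)
    ultimately show False using one by simp
  qed
  have unit: "x \<in> Units R" if x: "x \<in> carrier R" "x \<notin> M" for x
  proof -
    obtain y where y: "y \<in> carrier R" "x \<otimes> y = \<one>" using rinv[OF x] by blast
    \<comment> \<open>If \<open>y\<close> were in \<open>M\<close>, then
      \<open>\<one> \<ominus> y \<otimes> x\<close> would have a right inverse, yet \<open>x\<close>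
      times it is zero; this forces \<open>x = \<zero>\<close>, an element of
      \<open>M\<close>.\<close>
    have "y \<notin> M"
    proof
      assume "y \<in> M"
      then have "\<one> \<ominus> y \<otimes> x \<notin> M" using compl I_r_closed x by blast
      then obtain z where z: "z \<in> carrier R" "(\<one> \<ominus> y \<otimes> x) \<otimes> z = \<one>"
        using rinv x y by (metis minus_closed m_closed one_closed)
      have "x \<otimes> (\<one> \<ominus> y \<otimes> x) = x \<ominus> (x \<otimes> y) \<otimes> x"
        using x y(1) by (simp add: a_minus_def r_distr r_minus m_assoc)
      also have "\<dots> = \<zero>" using x y by (simp add: a_minus_def r_neg)
      finally have "x \<otimes> (\<one> \<ominus> y \<otimes> x) \<otimes> z = \<zero>" using z by simp
      then have "x = \<zero>" using x y z by (simp add: m_assoc)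
      then show False using x by simp
    qed
    then obtain w where w: "w \<in> carrier R" "y \<otimes> w = \<one>" using rinv y by blast
    \<comment> \<open>A right inverse \<open>w\<close> of the right inverse \<open>y\<close> of
      \<open>x\<close> is \<open>x\<close> itself, so \<open>y\<close> is a two-sided
      inverse.\<close>
    have "x = x \<otimes> (y \<otimes> w)" using x w by simp
    also have "\<dots> = x \<otimes> y \<otimes> w" using x y(1) w(1) by (simp add: m_assoc)
    also have "\<dots> = w" using y w by simp
    finally show ?thesis using x y w by (auto simp: Units_def)
  qed
  have nonunit: "x \<notin> Units R" if x: "x \<in> M" for x
  proof
    assume "x \<in> Units R"
    then have "x \<otimes> inv x = \<one>" "inv x \<in> carrier R" by auto
    then show False using I_r_closed[OF x] one by metis
  qed
  show eq: "jacobson_radical R = carrier R - Units R"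
    using J unit nonunit a_subset by blast
  \<comment> \<open>Left absorption: if \<open>x \<otimes> a\<close> had an inverse
    \<open>u\<close>, the unit \<open>\<one> \<ominus> a \<otimes> (u \<otimes> x)\<close> would
    annihilate \<open>a\<close>, so that \<open>a = \<zero>\<close> and
    \<open>\<one> = u \<otimes> (x \<otimes> \<zero>)\<close> would lie in \<open>M\<close>.\<close>
  have "x \<otimes> a \<in> M" if a: "a \<in> M" and x: "x \<in> carrier R" for a x
  proof (rule ccontr)
    have ac: "a \<in> carrier R" using a a_subset by blast
    assume "x \<otimes> a \<notin> M"
    then have U: "x \<otimes> a \<in> Units R" using unit ac x by simp
    define u where "u = inv (x \<otimes> a)"
    have u: "u \<in> carrier R" "u \<otimes> (x \<otimes> a) = \<one>" using U by (auto simp: u_def)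
    have axu: "a \<otimes> (u \<otimes> x) \<in> M" using I_r_closed[OF a] u x by simp
    then have V: "\<one> \<ominus> a \<otimes> (u \<otimes> x) \<in> Units R"
      using unit compl ac x u by simp
    have "(\<one> \<ominus> a \<otimes> (u \<otimes> x)) \<otimes> a = a \<ominus> a \<otimes> (u \<otimes> (x \<otimes> a))"
      using ac x u(1) by (simp add: a_minus_def l_distr l_minus m_assoc)
    also have "\<dots> = (\<one> \<ominus> a \<otimes> (u \<otimes> x)) \<otimes> \<zero>"
      using ac x u by (simp add: a_minus_def r_neg)
    finally have "a = \<zero>" using Units_l_cancel[OF V ac add.one_closed] by blast
    moreover have "u \<otimes> (x \<otimes> \<zero>) \<in> M" using u(1) x by simp
    ultimately have "\<one> \<in> M" using u(2) by simp
    then show False using one by simp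
  qed
  then show "ideal (jacobson_radical R) R"
    unfolding J using I_r_closed by (intro idealI a_subgroup ring_axioms) auto
qed

section \<open>Clean elements: units, their complements and conjugates\<close>

lemma minus_Units_swap:
  assumes xy: "x \<in> carrier R" "y \<in> carrier R" and U: "x \<ominus> y \<in> Units R"
  shows "y \<ominus> x \<in> Units R"
proof -
  have "y \<ominus> x = \<ominus> (x \<ominus> y)"
    using xy by (simp add: a_minus_def minus_add a_comm)
  also have "\<dots> = (\<ominus> \<one>) \<otimes> (x \<ominus> y)"
    using xy by (simp add: l_minus)
  finally have "y \<ominus> x = (\<ominus> \<one>) \<otimes> (x \<ominus> y)" .
  moreover have "\<ominus> \<one> \<in> Units R"
    by (auto simp: Units_def l_minus r_minus intro!: bexI[of _ "\<ominus> \<one>"])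
  ultimately show ?thesis using U by simp
qed

text \<open>The idempotent \<open>\<zero>\<close> is central, so it lies in every double commutant;
  the next lemma uses \<open>\<one>\<close> in the same way.\<close>

lemma perfectly_clean_elem_unit:
  assumes "a \<in> Units R"
  shows "perfectly_clean_elem R a"
proof -
  have "a \<ominus> \<zero> \<in> Units R" using assms by (simp add: a_minus_def Units_closed)
  then show ?thesis
    by (auto simp: perfectly_clean_elem_def double_commutant_def commutant_def intro!: bexI[of _ \<zero>])
qed

lemma perfectly_clean_elem_unit_compl:
  assumes "a \<in> carrier R" "\<one> \<ominus> a \<in> Units R"
  shows "perfectly_clean_elem R a"
proof -
  have "a \<ominus> \<one> \<in> Units R" using minus_Units_swap assms by simp
  then show ?thesis
    by (auto simp: perfectly_clean_elem_def double_commutant_def commutant_def intro!: bexI[of _ \<one>])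
qed

text \<open>Conjugation by \<open>u\<close> is a ring automorphism, so the conjugate of the
  idempotent found for \<open>d\<close> serves for the conjugate of \<open>d\<close>.\<close>

lemma perfectly_clean_elem_conjugate:
  assumes d: "d \<in> carrier R" and u: "u \<in> carrier R" "v \<in> carrier R" "u \<otimes> v = \<one>" "v \<otimes> u = \<one>"
    and pc: "perfectly_clean_elem R d"
  shows "perfectly_clean_elem R (u \<otimes> d \<otimes> v)"
proof -
  have cancel: "v \<otimes> (u \<otimes> x) = x" "u \<otimes> (v \<otimes> x) = x" if "x \<in> carrier R" for x
    using that u by (simp_all add: m_assoc[symmetric])
  obtain e where e: "e \<in> carrier R" "e \<otimes> e = e" "d \<ominus> e \<in> Units R"
    and comm: "\<And>y. y \<in> commutant R d \<Longrightarrow> e \<otimes> y = y \<otimes> e"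
    using pc by (auto simp: perfectly_clean_elem_def double_commutant_def)
  let ?e = "u \<otimes> e \<otimes> v"
  have "?e \<in> double_commutant R (u \<otimes> d \<otimes> v)"
    unfolding double_commutant_def
  proof (intro CollectI conjI ballI)
    show "?e \<in> carrier R" using u e by simp
    fix y assume "y \<in> commutant R (u \<otimes> d \<otimes> v)"
    then have y: "y \<in> carrier R" "y \<otimes> (u \<otimes> d \<otimes> v) = (u \<otimes> d \<otimes> v) \<otimes> y"
      by (auto simp: commutant_def)
    \<comment> \<open>Conjugating back moves \<open>y\<close> into the commutant of
      \<open>d\<close>, where \<open>e\<close> is known to commute with it.\<close>
    let ?y = "v \<otimes> y \<otimes> u"
    have "?y \<otimes> d = v \<otimes> (y \<otimes> (u \<otimes> d \<otimes> v)) \<otimes> u"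
      using y(1) u d by (simp add: m_assoc)
    also have "\<dots> = d \<otimes> ?y"
      unfolding y(2) using y(1) u d cancel by (simp add: m_assoc)
    finally have "?y \<in> commutant R d" using y u by (simp add: commutant_def)
    then have ey: "e \<otimes> ?y = ?y \<otimes> e" by (rule comm)
    have "?e \<otimes> y = u \<otimes> (e \<otimes> ?y) \<otimes> v"
      using y(1) u e(1) by (simp add: m_assoc)
    also have "\<dots> = y \<otimes> ?e"
      unfolding ey using y(1) u e(1) cancel by (simp add: m_assoc)
    finally show "?e \<otimes> y = y \<otimes> ?e" .
  qed
  moreover have "?e \<otimes> ?e = ?e"
  proof -
    have "?e \<otimes> ?e = u \<otimes> (e \<otimes> e) \<otimes> v" using u e(1) cancel by (simp add: m_assoc)
    then show ?thesis using e by simp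
  qed
  moreover have "u \<otimes> d \<otimes> v \<ominus> ?e \<in> Units R"
  proof -
    have "u \<otimes> d \<otimes> v \<ominus> ?e = u \<otimes> (d \<ominus> e) \<otimes> v"
      using u e d by (simp add: a_minus_def l_distr r_distr l_minus r_minus)
    moreover have "u \<in> Units R" "v \<in> Units R" using u by (auto simp: Units_def)
    ultimately show ?thesis using e by simp
  qed
  ultimately show ?thesis by (auto simp: perfectly_clean_elem_def)
qed

text \<open>Every \<open>a\<close> belongs to its own commutant, so the double commutant is
  contained in the commutant.\<close>

lemma perfectly_clean_imp_strongly_clean:
  assumes "perfectly_clean R"
  shows "strongly_clean R"
proof -
  have "double_commutant R a \<subseteq> commutant R a" if "a \<in> carrier R" for a
    using that by (auto simp: double_commutant_def commutant_def)
  then show ?thesis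
    using assms unfolding perfectly_clean_def strongly_clean_def perfectly_clean_elem_def
      strongly_clean_elem_def by blast
qed

end


section \<open>Two-by-two matrices\<close>

text \<open>Explicit entries let simplification turn matrix identities into identities between ring
  elements.\<close>

definition mat22 :: "'a \<Rightarrow> 'a \<Rightarrow> 'a \<Rightarrow> 'a \<Rightarrow> 'a mat" where
  "mat22 a b c d = mat 2 2 (\<lambda>(i, j). if i = 0 then (if j = 0 then a else b) else (if j = 0 then c else d))"

lemma mat22_carrier [simp]: "mat22 a b c d \<in> carrier_mat 2 2"
  by (simp add: mat22_def)

lemma mat22_dim [simp]: "dim_row (mat22 a b c d) = 2" "dim_col (mat22 a b c d) = 2"
  by (simp_all add: mat22_def)

lemma mat22_index [simp]:
  "mat22 a b c d $$ (0, 0) = a" "mat22 a b c d $$ (0, Suc 0) = b"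
  "mat22 a b c d $$ (Suc 0, 0) = c" "mat22 a b c d $$ (Suc 0, Suc 0) = d"
  by (simp_all add: mat22_def)

lemma mat22_eqI:
  assumes "A \<in> carrier_mat 2 2" "A $$ (0, 0) = a" "A $$ (0, Suc 0) = b"
    "A $$ (Suc 0, 0) = c" "A $$ (Suc 0, Suc 0) = d"
  shows "A = mat22 a b c d"
  using assms by (intro eq_matI) (auto simp: less_2_cases_iff)

lemma mat22_eq_iff [simp]:
  "mat22 a b c d = mat22 a' b' c' d' \<longleftrightarrow> a = a' \<and> b = b' \<and> c = c' \<and> d = d'"
  by (metis mat22_index)

lemma mat22_cases:
  assumes "A \<in> carrier_mat 2 2"
  obtains a b c d where "A = mat22 a b c d"
  using mat22_eqI[OF assms refl refl refl refl] by blast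

lemma mat22_mult [simp]:
  fixes a :: "'a :: semiring_0"
  shows "mat22 a b c d * mat22 a' b' c' d' =
    mat22 (a * a' + b * c') (a * b' + b * d') (c * a' + d * c') (c * b' + d * d')"
  by (rule mat22_eqI) (auto simp: scalar_prod_def numeral_2_eq_2 intro!: mult_carrier_mat[of _ 2 2])

lemma mat22_minus [simp]:
  fixes a :: "'a :: group_add"
  shows "mat22 a b c d - mat22 a' b' c' d' = mat22 (a - a') (b - b') (c - c') (d - d')"
  by (rule mat22_eqI) auto

lemma one_mat22: "1\<^sub>m 2 = mat22 1 0 0 1"
  by (rule mat22_eqI) auto

lemma zero_mat22: "0\<^sub>m 2 2 = mat22 0 0 0 0"
  by (rule mat22_eqI) auto

lemma diagonal_mat22 [simp]: "diagonal_mat (mat22 a b c d) \<longleftrightarrow> b = 0 \<and> c = 0"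
  by (auto simp: diagonal_mat_def less_2_cases_iff)

lemma units_class_ring: "x \<in> Units (class_ring :: 'a :: ring_1 ring) \<longleftrightarrow> (\<exists>y. y * x = 1 \<and> x * y = 1)"
  by (simp add: Units_def)

lemma diagonal_mat22_in_GL2:
  fixes a b :: "'a :: ring_1"
  assumes "a \<in> Units class_ring" "b \<in> Units class_ring"
  shows "mat22 a 0 0 b \<in> GL2 TYPE('a)"
proof -
  obtain a' b' where "a' * a = 1" "a * a' = 1" "b' * b = 1" "b * b' = 1"
    using assms by (auto simp: units_class_ring)
  then show ?thesis
    by (auto simp: Units_def ring_mat_simps one_mat22 intro!: bexI[of _ "mat22 a' 0 0 b'"])
qed

section \<open>Similarity and idempotent matrices\<close>

lemma similar_mat_obtain:
  assumes "similar_mat A D" "A \<in> carrier_mat n n"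
  obtains P Q where "P \<in> carrier_mat n n" "Q \<in> carrier_mat n n" "D \<in> carrier_mat n n"
    "P * Q = 1\<^sub>m n" "Q * P = 1\<^sub>m n" "A = P * D * Q"
  using assms similar_mat_witD2[OF assms(2)] unfolding similar_mat_def by metis

text \<open>Conjugating the commutation relation back by \<open>Q\<close> and \<open>P\<close>
  passes from an idempotent \<open>P * D * Q\<close> to its diagonal form \<open>D\<close>.\<close>

lemma conjugate_commutes:
  fixes A :: "'a :: semiring_1 mat"
  assumes "A \<in> carrier_mat n n" "D \<in> carrier_mat n n" "P \<in> carrier_mat n n" "Q \<in> carrier_mat n n"
    and PQ: "P * Q = 1\<^sub>m n" "Q * P = 1\<^sub>m n"
    and comm: "A * (P * D * Q) = (P * D * Q) * A"
  shows "(Q * A * P) * D = D * (Q * A * P)"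
proof -
  note c = assms(1-4)
  note assoc = assoc_mult_mat[where n\<^sub>1 = n and n\<^sub>2 = n and n\<^sub>3 = n and n\<^sub>4 = n]
  have cancel: "Q * (P * X) = X" if "X \<in> carrier_mat n n" for X
    using that c PQ by (simp add: assoc[symmetric])
  have "(Q * A * P) * D = Q * (A * (P * D * Q)) * P"
    using c PQ by (simp add: assoc)
  also have "\<dots> = D * (Q * A * P)"
    unfolding comm using c PQ cancel by (simp add: assoc)
  finally show ?thesis .
qed

lemma similar_mat_conjugate:
  fixes A :: "'a :: semiring_1 mat"
  assumes c: "A \<in> carrier_mat n n" "P \<in> carrier_mat n n" "Q \<in> carrier_mat n n"
    and PQ: "P * Q = 1\<^sub>m n" "Q * P = 1\<^sub>m n"
  shows "similar_mat A (Q * A * P)"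
proof (rule similar_matI)
  note assoc = assoc_mult_mat[where n\<^sub>1 = n and n\<^sub>2 = n and n\<^sub>3 = n and n\<^sub>4 = n]
  have cancel: "P * (Q * X) = X" if "X \<in> carrier_mat n n" for X
    using that c PQ by (simp add: assoc[symmetric])
  show "A = P * (Q * A * P) * Q"
    using c PQ cancel by (simp add: assoc)
qed (use c PQ in auto)

text \<open>The conjugating matrix has as columns \<open>E e\<^sub>1\<close> and \<open>(1 - E) e\<^sub>2\<close>, on which \<open>E\<close> acts as \<open>1\<close> and \<open>0\<close>;
  in its inverse, \<open>E e\<^sub>2 = E e\<^sub>1 a q\<close> and \<open>(1 - E) e\<^sub>1 = - (1 - E) e\<^sub>2 b r\<close> give the off-diagonal entries.\<close>

lemma idempotent_mat22_similar:
  fixes p q r s :: "'a :: ring_1"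
  assumes idem: "mat22 p q r s * mat22 p q r s = mat22 p q r s"
    and "p \<in> Units class_ring" "1 - s \<in> Units class_ring"
  shows "similar_mat (mat22 p q r s) (mat22 1 0 0 0)"
proof -
  obtain a b where a: "a * p = 1" "p * a = 1" and b: "b * (1 - s) = 1" "(1 - s) * b = 1"
    using assms by (auto simp: units_class_ring)
  have e: "p * p + q * r = p" "p * q + q * s = q" "r * p + s * r = r" "r * q + s * s = s"
    using idem by auto
  have e': "q * r = p * (1 - p)" "p * q = q * (1 - s)" "r * p = (1 - s) * r" "r * q = (1 - s) * s"
    using e by (simp_all add: algebra_simps)
  \<comment> \<open>Inverses are moved across the off-diagonal entries:
    \<open>p * q = q * (1 - s)\<close> is multiplied by \<open>a\<close> on the left and
    \<open>b\<close> on the right. The fact \<open>ra\<close> below comes from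
    \<open>r * p = (1 - s) * r\<close> in the same manner.\<close>
  have aq: "a * q = q * b"
  proof -
    have "a * (p * q) * b = q * b" using a by (simp add: mult.assoc[symmetric])
    moreover have "a * (q * (1 - s)) * b = a * q" using b by (simp add: mult.assoc)
    ultimately show ?thesis using e' by simp
  qed
  have aqr: "a * (q * r) = 1 - p" using a e' by (simp add: mult.assoc[symmetric])
  have brp: "b * (r * p) = r" using b e' by (simp add: mult.assoc[symmetric])
  have brq: "b * (r * q) = s" using b e' by (simp add: mult.assoc[symmetric])
  have ra: "r * a = b * r"
  proof -
    have "b * (r * p) * a = b * r" using a by (simp add: mult.assoc)
    then show ?thesis using brp by simp
  qed
  have raq: "r * (a * q) = s" using ra brq by (simp add: mult.assoc[symmetric])
  have qbr: "q * (b * r) = 1 - p" using aq aqr by (simp add: mult.assoc[symmetric])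
  have paq: "p * (a * q) = q" using a by (simp add: mult.assoc[symmetric])
  have sbr: "(1 - s) * (b * r) = r" using b by (simp add: mult.assoc[symmetric])
  have aqs: "a * (q * (1 - s)) = q" using aq b by (simp add: mult.assoc[symmetric]) (simp add: mult.assoc)
  have fst: "mat22 p (- q) r (1 - s) * mat22 1 (a * q) (- (b * r)) 1 = 1\<^sub>m 2"
    by (simp add: one_mat22 paq qbr raq sbr)
  have snd: "mat22 1 (a * q) (- (b * r)) 1 * mat22 p (- q) r (1 - s) = 1\<^sub>m 2"
    by (simp add: one_mat22 mult.assoc aqr aqs brp brq)
  show ?thesis
    by (rule similar_matI[OF _ fst snd]) (simp_all add: paq raq)
qed

text \<open>This is the complementary idempotent \<open>1 - E\<close>; replacing \<open>E\<close> by
  it settles two of the four cases in \<open>idempotent_mat2_cases\<close>.\<close>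

lemma idempotent_mat22_compl:
  fixes p q r s :: "'a :: ring_1"
  assumes "mat22 p q r s * mat22 p q r s = mat22 p q r s"
  shows "mat22 (1 - p) (- q) (- r) (1 - s) * mat22 (1 - p) (- q) (- r) (1 - s)
    = mat22 (1 - p) (- q) (- r) (1 - s)"
  using assms by (simp add: algebra_simps)

text \<open>Multiplying by \<open>D\<close> on one side keeps one off-diagonal entry of
  \<open>X\<close> and kills the other, and on the other side the roles are exchanged; equality
  makes both vanish.\<close>

lemma diagonal_if_commutes_with_diagonal_idempotent:
  fixes X :: "'a :: ring_1 mat"
  assumes "X \<in> carrier_mat 2 2" "D \<in> {mat22 1 0 0 0, mat22 0 0 0 1}" "X * D = D * X"
  shows "diagonal_mat X"
  using assms by (elim mat22_cases) auto


section \<open>Matrices over a local ring\<close>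

context
  assumes local: "local_ring (class_ring :: 'a :: ring_1 ring)"
begin

abbreviation (input) J :: "'a set" where "J \<equiv> jacobson_radical class_ring"

section \<open>The radical as the set of nonunits, and the classification of idempotents\<close>

lemma J_iff: "x \<in> J \<longleftrightarrow> x \<notin> Units class_ring"
  using ring.local_ring_radical_eq_nonunits[OF _ local] class_ring.ring_axioms by auto

lemma J_ideal: "ideal J class_ring"
  by (rule ring.local_ring_radical_ideal[OF _ local]) (rule class_ring.ring_axioms)

lemma J_mult: "x \<in> J \<Longrightarrow> x * y \<in> J" "x \<in> J \<Longrightarrow> y * x \<in> J"
  using ideal.I_r_closed[OF J_ideal] ideal.I_l_closed[OF J_ideal] by auto

lemma one_minus_unit: "x \<in> J \<Longrightarrow> 1 - x \<in> Units class_ring"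
proof (rule ccontr)
  assume x: "x \<in> J" and "1 - x \<notin> Units class_ring"
  then have "1 - x \<in> J" by (simp add: J_iff)
  then have "(1 - x) + x \<in> J"
    using additive_subgroup.a_closed[OF ideal.axioms(1)[OF J_ideal] _ x] by fastforce
  then show False by (simp add: J_iff units_class_ring)
qed

lemma mult_in_J: "x * y \<in> J \<Longrightarrow> x \<in> J \<or> y \<in> J"
proof -
  have "x * y \<in> Units class_ring" if "x \<in> Units class_ring" "y \<in> Units class_ring"
    using monoid.Units_m_closed[OF ring.is_monoid[OF class_ring.ring_axioms] that] by simp
  then show "x * y \<in> J \<Longrightarrow> x \<in> J \<or> y \<in> J" by (auto simp: J_iff)
qed

text \<open>As \<open>1 - p\<close> and \<open>1 - s\<close> are invertible, idempotency writes each
  entry as a multiple of another one. Going round once gives \<open>q = q * (k * j)\<close> and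
  \<open>r = r * (j * k)\<close> with both products in the radical, so \<open>q\<close> and
  \<open>r\<close> vanish, and \<open>p\<close> and \<open>s\<close> with them.\<close>

lemma idempotent_mat22_zero:
  assumes idem: "mat22 p q r s * mat22 p q r s = mat22 p q r s" and ps: "p \<in> J" "s \<in> J"
  shows "mat22 p q r s = 0\<^sub>m 2 2"
proof -
  obtain a b where a: "a * (1 - p) = 1" "(1 - p) * a = 1" and b: "b * (1 - s) = 1" "(1 - s) * b = 1"
    using ps one_minus_unit by (meson units_class_ring)
  have e: "p * p + q * r = p" "p * q + q * s = q" "r * p + s * r = r" "r * q + s * s = s"
    using idem by auto
  have e': "q * r = p * (1 - p)" "p * q = q * (1 - s)" "s * r = r * (1 - p)" "r * q = s * (1 - s)"
    using e by (simp_all add: algebra_simps)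
  define j k where "j = q * b" and "k = r * a"
  have p: "p = q * k" unfolding k_def using e' a by (simp add: mult.assoc[symmetric]) (simp add: mult.assoc)
  have q: "q = p * j" unfolding j_def using e' b by (simp add: mult.assoc[symmetric]) (simp add: mult.assoc)
  have r: "r = s * k" unfolding k_def using e' a by (simp add: mult.assoc[symmetric]) (simp add: mult.assoc)
  have s: "s = r * j" unfolding j_def using e' b by (simp add: mult.assoc[symmetric]) (simp add: mult.assoc)
  \<comment> \<open>Since nonunits absorb and units multiply to units, one of \<open>q\<close> and
    \<open>r\<close> must lie in the radical, which suffices for both products of \<open>j\<close>
    and \<open>k\<close>.\<close>
  have "q * r \<in> J" using e' ps J_mult by simp
  then have "j \<in> J \<or> k \<in> J" unfolding j_def k_def using mult_in_J J_mult by blast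
  then have kj: "k * j \<in> J" "j * k \<in> J" using J_mult by auto
  have cancel: "x = 0" if xy: "x = x * y" and y: "y \<in> J" for x y :: 'a
  proof -
    obtain z where z: "(1 - y) * z = 1" using one_minus_unit[OF y] by (auto simp: units_class_ring)
    have "x * (1 - y) = 0" using xy by (simp add: right_diff_distrib)
    then have "x * (1 - y) * z = 0" by simp
    then show ?thesis using z by (simp add: mult.assoc)
  qed
  have "q = q * (k * j)" using p q by (metis mult.assoc)
  then have "q = 0" using cancel kj by blast
  moreover have "r = r * (j * k)" using r s by (metis mult.assoc)
  then have "r = 0" using cancel kj by blast
  ultimately show ?thesis using p s by (simp add: zero_mat22)
qed

text \<open>For each ring element \<open>x\<close>, either \<open>x\<close> or \<open>1 - x\<close>
  is a unit. Applied to both diagonal entries, this leaves four cases, handled by the two lemmas on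
  \<open>E\<close> and by the same lemmas on \<open>1 - E\<close>.\<close>

lemma idempotent_mat2_cases:
  fixes E :: "'a mat"
  assumes E: "E \<in> carrier_mat 2 2" and idem: "E * E = E"
  shows "E = 0\<^sub>m 2 2 \<or> E = 1\<^sub>m 2 \<or> (\<exists>D \<in> {mat22 1 0 0 0, mat22 0 0 0 1}. similar_mat E D)"
proof -
  obtain p q r s where eq: "E = mat22 p q r s" using E by (rule mat22_cases)
  let ?F = "mat22 (1 - p) (- q) (- r) (1 - s)"
  have idem: "E * E = E" "?F * ?F = ?F"
    using idem idempotent_mat22_compl unfolding eq by blast+
  have unit: "x \<in> Units class_ring \<or> 1 - x \<in> Units class_ring" for x :: 'a
    using one_minus_unit[of x] by (auto simp: J_iff)
  consider (E) "p \<in> Units class_ring" "1 - s \<in> Units class_ring"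
    | (F) "1 - p \<in> Units class_ring" "s \<in> Units class_ring"
    | (zero) "p \<in> J" "s \<in> J" | (one) "1 - p \<in> J" "1 - s \<in> J"
    using unit[of p] unit[of s] by (auto simp: J_iff)
  then show ?thesis
  proof cases
    case E
    then show ?thesis using idempotent_mat22_similar idem eq by blast
  next
    case F
    then have "similar_mat ?F (mat22 1 0 0 0)"
      using idempotent_mat22_similar[OF idem(2)] by simp
    then obtain P Q where PQ: "P \<in> carrier_mat 2 2" "Q \<in> carrier_mat 2 2"
      "P * Q = 1\<^sub>m 2" "Q * P = 1\<^sub>m 2" "?F = P * mat22 1 0 0 0 * Q"
      by (rule similar_mat_obtain[OF _ mat22_carrier])
    \<comment> \<open>The matrices that diagonalise \<open>1 - E\<close> to
      \<open>diag(1, 0)\<close> diagonalise \<open>E\<close> to the complement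
      \<open>diag(0, 1)\<close>.\<close>
    have "P * mat22 0 0 0 1 * Q = P * (1\<^sub>m 2 - mat22 1 0 0 0) * Q" by (simp add: one_mat22)
    also have "\<dots> = (P * 1\<^sub>m 2 - P * mat22 1 0 0 0) * Q"
      using PQ by (subst mult_minus_distrib_mat[of _ 2 2]) auto
    also have "\<dots> = P * Q - P * mat22 1 0 0 0 * Q"
      using PQ by (subst minus_mult_distrib_mat[of _ 2 2]) auto
    also have "\<dots> = 1\<^sub>m 2 - ?F" using PQ by simp
    also have "\<dots> = E" by (simp add: one_mat22 eq)
    finally have "similar_mat E (mat22 0 0 0 1)"
      using PQ E by (intro similar_matI[OF _ PQ(3,4)]) auto
    then show ?thesis by blast
  next
    case zero
    then show ?thesis using idempotent_mat22_zero idem eq by blast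
  next
    case one
    then have "?F = 0\<^sub>m 2 2" using idempotent_mat22_zero idem by blast
    then show ?thesis by (simp add: eq one_mat22 zero_mat22)
  qed
qed

section \<open>From strong cleanness to diagonalisation\<close>

lemma strongly_clean_mat2_cases:
  fixes A :: "'a mat"
  assumes A: "A \<in> carrier_mat 2 2" and sc: "strongly_clean_elem (mat2_ring TYPE('a)) A"
  shows "A \<in> GL2 TYPE('a) \<or> 1\<^sub>m 2 - A \<in> GL2 TYPE('a) \<or> (\<exists>D. diagonal_mat D \<and> similar_mat A D)"
proof -
  interpret M: ring "mat2_ring TYPE('a)" by (rule ring_ring_mat)
  obtain E where E: "E \<in> carrier_mat 2 2" "E * A = A * E" "E * E = E" "A - E \<in> GL2 TYPE('a)"
    using sc A by (auto simp: strongly_clean_elem_def commutant_def ring_mat_simps ring_mat_minus)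
  show ?thesis
    using idempotent_mat2_cases[OF E(1,3)]
  proof (elim disjE bexE)
    assume "E = 0\<^sub>m 2 2"
    moreover have "A - 0\<^sub>m 2 2 = A" using A by (intro eq_matI) auto
    ultimately show ?thesis using E(4) by simp
  next
    assume "E = 1\<^sub>m 2"
    then have "A \<ominus>\<^bsub>mat2_ring TYPE('a)\<^esub> 1\<^sub>m 2 \<in> GL2 TYPE('a)"
      using E(4) A by (simp add: ring_mat_minus)
    then have "1\<^sub>m 2 \<ominus>\<^bsub>mat2_ring TYPE('a)\<^esub> A \<in> GL2 TYPE('a)"
      using A by (intro M.minus_Units_swap[of A]) (auto simp: ring_mat_simps)
    then show ?thesis using A by (simp add: ring_mat_minus)
  next
    fix D :: "'a mat" assume D: "D \<in> {mat22 1 0 0 0, mat22 0 0 0 1}" "similar_mat E D"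
    obtain P Q where PQ: "P \<in> carrier_mat 2 2" "Q \<in> carrier_mat 2 2" "D \<in> carrier_mat 2 2"
      "P * Q = 1\<^sub>m 2" "Q * P = 1\<^sub>m 2" "E = P * D * Q"
      using D(2) E(1) by (rule similar_mat_obtain)
    \<comment> \<open>\<open>A\<close> commutes with \<open>E = P * D * Q\<close>, so the conjugate
      of \<open>A\<close> commutes with \<open>D\<close> and is therefore diagonal.\<close>
    have "(Q * A * P) * D = D * (Q * A * P)"
      using conjugate_commutes[OF A PQ(3,1,2,4,5)] E(2) PQ(6) by simp
    then have "diagonal_mat (Q * A * P)"
      using diagonal_if_commutes_with_diagonal_idempotent[OF _ D(1)] A PQ by simp
    then show ?thesis using similar_mat_conjugate[OF A PQ(1,2,4,5)] by blast
  qed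
qed

section \<open>Perfect cleanness of diagonalisable matrices\<close>

lemma perfectly_clean_diagonal_mat22:
  assumes wc: "weakly_cobleached (class_ring :: 'a ring)"
    and ab: "a \<in> J \<and> 1 - b \<in> J \<or> 1 - a \<in> J \<and> b \<in> J"
  shows "perfectly_clean_elem (mat2_ring TYPE('a)) (mat22 a 0 0 b)"
proof -
  \<comment> \<open>An injective additive map kills only \<open>0\<close>, and \<open>b\<close> is
    one plus the radical element \<open>b - 1\<close>. Here \<open>a\<close> and \<open>b\<close>
    are arbitrary, so that the two alternatives in \<open>ab\<close> are served by exchanging
    them.\<close>
  have inj: "y = 0" if "a \<in> J" "1 - b \<in> J" "y * b = a * y \<or> y * a = b * y" for a b y :: 'a
  proof -
    have "- (1 - b) \<in> J" using J_mult(1)[OF that(2), of "- 1"] by simp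
    then have "b \<in> {1 + j | j. j \<in> J}" by (auto intro!: exI[of _ "b - 1"])
    then have "inj (\<lambda>x. a * x - x * b)" "inj (\<lambda>x. b * x - x * a)"
      using wc that(1) by (auto simp: weakly_cobleached_def class_ring_minus)
    from injD[OF this(1), of y 0] injD[OF this(2), of y 0] show ?thesis
      using that(3) by auto
  qed
  have swap: "x - 1 \<in> Units class_ring" if "x \<in> J" for x
    using ring.minus_Units_swap[OF class_ring.ring_axioms, of 1 x] one_minus_unit[OF that]
    by (simp add: class_ring_minus)
  \<comment> \<open>The idempotent \<open>diag(e, f)\<close> has its \<open>1\<close> at the radical
    entry, where subtracting it produces a unit, and its \<open>0\<close> at the entry that is
    already a unit.\<close>
  obtain e f :: 'a where ef: "e = 1 \<and> f = 0 \<or> e = 0 \<and> f = 1"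
    and u: "a - e \<in> Units class_ring" "b - f \<in> Units class_ring"
    using ab
  proof
    assume "a \<in> J \<and> 1 - b \<in> J"
    then show thesis
      using that[of 1 0] swap[of a] one_minus_unit[of "1 - b"] by simp
  next
    assume "1 - a \<in> J \<and> b \<in> J"
    then show thesis
      using that[of 0 1] swap[of b] one_minus_unit[of "1 - a"] by simp
  qed
  \<comment> \<open>These are the conditions on the off-diagonal entries of a matrix commuting with
    \<open>diag(a, b)\<close>.\<close>
  have comm: "y = 0 \<and> z = 0" if yz: "y * b = a * y" "z * a = b * z" for y z
    using ab
  proof
    assume "a \<in> J \<and> 1 - b \<in> J"
    then show ?thesis using inj[of a b y] inj[of a b z] yz by blast
  next
    assume "1 - a \<in> J \<and> b \<in> J"
    then show ?thesis using inj[of b a y] inj[of b a z] yz by blast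
  qed
  show ?thesis
    unfolding perfectly_clean_elem_def double_commutant_def
  proof (intro bexI[of _ "mat22 e 0 0 f"] conjI CollectI ballI)
    fix Y assume "Y \<in> commutant (mat2_ring TYPE('a)) (mat22 a 0 0 b)"
    then have Y: "Y \<in> carrier_mat 2 2" "Y * mat22 a 0 0 b = mat22 a 0 0 b * Y"
      by (auto simp: commutant_def ring_mat_simps)
    obtain x y z w where eq: "Y = mat22 x y z w" using Y(1) by (rule mat22_cases)
    then have "y * b = a * y" "z * a = b * z" using Y(2) by auto
    then have "y = 0 \<and> z = 0" by (rule comm)
    then show "mat22 e 0 0 f \<otimes>\<^bsub>mat2_ring TYPE('a)\<^esub> Y = Y \<otimes>\<^bsub>mat2_ring TYPE('a)\<^esub> mat22 e 0 0 f"
      using ef by (auto simp: eq ring_mat_simps)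
  next
    show "mat22 a 0 0 b \<ominus>\<^bsub>mat2_ring TYPE('a)\<^esub> mat22 e 0 0 f \<in> Units (mat2_ring TYPE('a))"
      using diagonal_mat22_in_GL2[OF u] by (simp add: ring_mat_minus)
  qed (use ef in \<open>auto simp: ring_mat_simps\<close>)
qed

lemma perfectly_clean_mat2_of_diagonalizable:
  fixes A :: "'a mat"
  assumes wc: "weakly_cobleached (class_ring :: 'a ring)"
    and A: "A \<in> carrier_mat 2 2"
    and D: "diagonal_mat D" "similar_mat A D"
  shows "perfectly_clean_elem (mat2_ring TYPE('a)) A"
proof -
  interpret M: ring "mat2_ring TYPE('a)" by (rule ring_ring_mat)
  obtain P Q where PQ: "P \<in> carrier_mat 2 2" "Q \<in> carrier_mat 2 2" "D \<in> carrier_mat 2 2"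
    "P * Q = 1\<^sub>m 2" "Q * P = 1\<^sub>m 2" "A = P * D * Q"
    using D(2) A by (rule similar_mat_obtain)
  obtain a b where eq: "D = mat22 a 0 0 b"
    using PQ(3) D(1) by (elim mat22_cases) auto
  have compl: "\<one>\<^bsub>mat2_ring TYPE('a)\<^esub> \<ominus>\<^bsub>mat2_ring TYPE('a)\<^esub> D = mat22 (1 - a) 0 0 (1 - b)"
    by (simp add: ring_mat_minus eq ring_mat_simps one_mat22)
  \<comment> \<open>In the first two cases \<open>D\<close> or its complement is invertible; only
    the mixed case calls on weak cobleachedness.\<close>
  consider (unit) "a \<in> Units class_ring" "b \<in> Units class_ring"
    | (compl) "1 - a \<in> Units class_ring" "1 - b \<in> Units class_ring"
    | (mixed) "a \<in> J \<and> 1 - b \<in> J \<or> 1 - a \<in> J \<and> b \<in> J"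
    using one_minus_unit[of a] one_minus_unit[of b] by (auto simp: J_iff)
  then have "perfectly_clean_elem (mat2_ring TYPE('a)) D"
  proof cases
    case unit
    then show ?thesis using M.perfectly_clean_elem_unit diagonal_mat22_in_GL2 eq by blast
  next
    case compl
    then have "\<one>\<^bsub>mat2_ring TYPE('a)\<^esub> \<ominus>\<^bsub>mat2_ring TYPE('a)\<^esub> D \<in> GL2 TYPE('a)"
      using diagonal_mat22_in_GL2 \<open>_ = mat22 (1 - a) 0 0 (1 - b)\<close> by metis
    then show ?thesis
      using PQ(3) by (intro M.perfectly_clean_elem_unit_compl) (auto simp: ring_mat_simps)
  next
    case mixed
    then show ?thesis unfolding eq by (rule perfectly_clean_diagonal_mat22[OF wc])
  qed
  then show ?thesis
    using M.perfectly_clean_elem_conjugate[of D P Q] PQ by (simp add: ring_mat_simps)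
qed

lemma perfectly_clean_mat2:
  assumes wc: "weakly_cobleached (class_ring :: 'a ring)"
    and cases: "\<And>A :: 'a mat. A \<in> carrier_mat 2 2 \<Longrightarrow>
      A \<in> GL2 TYPE('a) \<or> 1\<^sub>m 2 - A \<in> GL2 TYPE('a) \<or> (\<exists>D. diagonal_mat D \<and> similar_mat A D)"
  shows "perfectly_clean (mat2_ring TYPE('a))"
  unfolding perfectly_clean_def
proof
  interpret M: ring "mat2_ring TYPE('a)" by (rule ring_ring_mat)
  fix A :: "'a mat" assume "A \<in> carrier (mat2_ring TYPE('a))"
  then have A: "A \<in> carrier_mat 2 2" by (simp add: ring_mat_simps)
  show "perfectly_clean_elem (mat2_ring TYPE('a)) A"
    using cases[OF A]
  proof (elim disjE exE conjE)
    assume "1\<^sub>m 2 - A \<in> GL2 TYPE('a)"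
    then have "\<one>\<^bsub>mat2_ring TYPE('a)\<^esub> \<ominus>\<^bsub>mat2_ring TYPE('a)\<^esub> A \<in> GL2 TYPE('a)"
      using A by (simp add: ring_mat_minus ring_mat_simps)
    then show ?thesis
      using A by (intro M.perfectly_clean_elem_unit_compl) (auto simp: ring_mat_simps)
  qed (use perfectly_clean_mat2_of_diagonalizable[OF wc A] M.perfectly_clean_elem_unit in blast)+
qed

end

theorem theorem3p2:
  assumes "local_ring (class_ring :: 'a :: ring_1 ring)"
    and "weakly_cobleached (class_ring :: 'a ring)"
  shows "(perfectly_clean (mat2_ring TYPE('a)) \<longleftrightarrow> strongly_clean (mat2_ring TYPE('a))) \<and>
    (strongly_clean (mat2_ring TYPE('a)) \<longleftrightarrow>
      (\<forall>A \<in> carrier (mat2_ring TYPE('a)).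
         A \<in> GL2 TYPE('a) \<or> 1\<^sub>m 2 - A \<in> GL2 TYPE('a) \<or>
         (\<exists>D. diagonal_mat D \<and> similar_mat A D)))"
proof -
  interpret M: ring "mat2_ring TYPE('a)" by (rule ring_ring_mat)
  let ?three = "\<forall>A \<in> carrier (mat2_ring TYPE('a)). A \<in> GL2 TYPE('a) \<or>
    1\<^sub>m 2 - A \<in> GL2 TYPE('a) \<or> (\<exists>D. diagonal_mat D \<and> similar_mat A D)"
  have "strongly_clean (mat2_ring TYPE('a)) \<Longrightarrow> ?three"
    using strongly_clean_mat2_cases[OF assms(1)] by (simp add: strongly_clean_def ring_mat_simps)
  moreover have "?three \<Longrightarrow> perfectly_clean (mat2_ring TYPE('a))"
    using perfectly_clean_mat2[OF assms] by (simp add: ring_mat_simps)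
  ultimately show ?thesis
    using M.perfectly_clean_imp_strongly_clean by blast
qed

end
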